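(* Let $G$ be a topological gyrogroup and $H$ a closed $L$-subgyrogroup of $G$. If $H$ is first-countable and the quotient space $G/H$ has an $\omega^{\omega}$-base, then $G$ has an $\omega^{\omega}$-base.
   Context: All topological spaces are assumed Hausdorff; $\mathbb{N}$ is the set of positive integers. A groupoid $(G,\oplus)$ (a set with a binary operation) is a gyrogroup if: (G1) there is a unique identity element $0\in G$ with $0\oplus a=a=a\oplus 0$ for all $a\in G$; (G2) for every $x\in G$ there is a unique inverse $\ominus x\in G$ with $\ominus x\oplus x=0=x\oplus(\ominus x)$; (G3) for all $x,y\in G$ there is an automorphism $\mathrm{gyr}[x,y]\in \mathrm{Aut}(G,\oplus)$ with $x\oplus(y\oplus z)=(x\oplus y)\oplus \mathrm{gyr}[x,y](z)$ for all $z\in G$; (G4) $\mathrm{gyr}[x\oplus y,y]=\mathrm{gyr}[x,y]$ for all $x,y\in G$. A topological gyrogroup is a gyrogroup $(G,\oplus)$ with a topology such that $\oplus:G\times G\to G$ is jointly continuous (product topology on $G\times G$) and $x\mapsto\ominus x$ is continuous. A nonempty subset $H\subset G$ is a subgyrogroup if $H$ is a gyrogroup under the inherited operation and the restriction of $\mathrm{gyr}[a,b]$ to $H$ is an automorphism of $H$ for all $a,b\in H$. It is an $L$-subgyrogroup if in addition $\mathrm{gyr}[a,h](H)=H$ for all $a\in G$, $h\in H$. For an $L$-subgyrogroup $H$, the left cosets $a\oplus H$ ($a\in G$) partition $G$; $G/H=\{a\oplus H:a\in G\}$ carries the quotient topology with respect to $\pi:G\to G/H$, $\pi(a)=a\oplus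 H$, i.e. $O\subset G/H$ is open iff $\pi^{-1}(O)$ is open in $G$. $\mathbb{N}^{\mathbb{N}}$ is the set of functions $\mathbb{N}\to\mathbb{N}$ with the pointwise partial order: $f\le g$ iff $f(n)\le g(n)$ for all $n$. A space $X$ has an $\omega^{\omega}$-base if at each $x\in X$ there is a neighborhood base $\{U_{\alpha}(x):\alpha\in\mathbb{N}^{\mathbb{N}}\}$ at $x$ with $U_{\beta}(x)\subset U_{\alpha}(x)$ whenever $\alpha\le\beta$. *)

theory Defs
  imports "HOL-Analysis.Analysis" "HOL-Algebra.Left_Coset"
begin

text \<open>
  Gyrogroups are modelled on the record type of HOL-Algebra, so that \<open>\<otimes>\<close>, \<open>\<one>\<close> and \<open>inv\<close> stand
  for the gyrogroup operation, its identity and its inverse.  The operation is not associative,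
  so none of the locales \<open>monoid\<close>, \<open>group\<close> applies.  As with every function on a carrier, only
  the values of \<open>gyr x y\<close> for arguments in the carrier matter.
\<close>

locale gyrogroup =
  fixes G :: "('a, 'b) monoid_scheme" (structure)
    and gyr :: "'a \<Rightarrow> 'a \<Rightarrow> 'a \<Rightarrow> 'a"
  assumes m_closed: "\<lbrakk>x \<in> carrier G; y \<in> carrier G\<rbrakk> \<Longrightarrow> x \<otimes> y \<in> carrier G"
    and one_closed: "\<one> \<in> carrier G"
    and l_one: "x \<in> carrier G \<Longrightarrow> \<one> \<otimes> x = x"
    and r_one: "x \<in> carrier G \<Longrightarrow> x \<otimes> \<one> = x"
    and one_unique: "\<lbrakk>e \<in> carrier G; \<And>x. x \<in> carrier G \<Longrightarrow> e \<otimes> x = x \<and> x \<otimes> e = x\<rbrakk> \<Longrightarrow> e = \<one>"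
    and inv_ex1: "x \<in> carrier G \<Longrightarrow> \<exists>!y. y \<in> carrier G \<and> y \<otimes> x = \<one> \<and> x \<otimes> y = \<one>"
    and gyr_aut: "\<lbrakk>x \<in> carrier G; y \<in> carrier G\<rbrakk> \<Longrightarrow> gyr x y \<in> iso G G"
    and gyr_assoc: "\<lbrakk>x \<in> carrier G; y \<in> carrier G; z \<in> carrier G\<rbrakk>
          \<Longrightarrow> x \<otimes> (y \<otimes> z) = (x \<otimes> y) \<otimes> gyr x y z"
    and gyr_loop: "\<lbrakk>x \<in> carrier G; y \<in> carrier G; z \<in> carrier G\<rbrakk>
          \<Longrightarrow> gyr (x \<otimes> y) y z = gyr x y z"

locale topological_gyrogroup = gyrogroup G gyr
  for G :: "('a, 'b) monoid_scheme" (structure) and gyr +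
  fixes T :: "'a topology"
  assumes topspace_eq: "topspace T = carrier G"
    and Hausdorff: "Hausdorff_space T"
    and continuous_mult: "continuous_map (prod_topology T T) T (\<lambda>(x, y). x \<otimes> y)"
    and continuous_inv: "continuous_map T T (\<lambda>x. inv x)"

text \<open>
  That \<open>H\<close> is a gyrogroup in its own right does not presuppose that its identity and its
  gyrations are those of \<open>G\<close>, whence the two existential quantifiers.
\<close>

definition subgyrogroup ::
    "('a, 'b) monoid_scheme \<Rightarrow> ('a \<Rightarrow> 'a \<Rightarrow> 'a \<Rightarrow> 'a) \<Rightarrow> 'a set \<Rightarrow> bool" where
  "subgyrogroup G gyr H \<longleftrightarrow>
     H \<noteq> {} \<and> H \<subseteq> carrier G \<and>
     (\<exists>e gyr'. gyrogroup (G\<lparr>carrier := H, one := e\<rparr>) gyr') \<and>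
     (\<forall>a\<in>H. \<forall>b\<in>H. gyr a b \<in> iso (G\<lparr>carrier := H\<rparr>) (G\<lparr>carrier := H\<rparr>))"

definition L_subgyrogroup ::
    "('a, 'b) monoid_scheme \<Rightarrow> ('a \<Rightarrow> 'a \<Rightarrow> 'a \<Rightarrow> 'a) \<Rightarrow> 'a set \<Rightarrow> bool" where
  "L_subgyrogroup G gyr H \<longleftrightarrow>
     subgyrogroup G gyr H \<and> (\<forall>a\<in>carrier G. \<forall>h\<in>H. gyr a h ` H = H)"

definition coset_topology ::
    "('a, 'b) monoid_scheme \<Rightarrow> 'a topology \<Rightarrow> 'a set \<Rightarrow> 'a set topology" where
  "coset_topology G T H =
     topology (\<lambda>V. V \<subseteq> lcosets\<^bsub>G\<^esub> H \<and> openin T {a \<in> carrier G. a <#\<^bsub>G\<^esub> H \<in> V})"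

lemma openin_coset_topology:
  "openin (coset_topology G T H) V \<longleftrightarrow>
     V \<subseteq> lcosets\<^bsub>G\<^esub> H \<and> openin T {a \<in> carrier G. a <#\<^bsub>G\<^esub> H \<in> V}"
proof -
  have "istopology (\<lambda>V. V \<subseteq> lcosets\<^bsub>G\<^esub> H \<and> openin T {a \<in> carrier G. a <#\<^bsub>G\<^esub> H \<in> V})"
    unfolding istopology_def
  proof (intro conjI allI impI)
    fix S U
    assume "S \<subseteq> lcosets\<^bsub>G\<^esub> H \<and> openin T {a \<in> carrier G. a <#\<^bsub>G\<^esub> H \<in> S}"
      and "U \<subseteq> lcosets\<^bsub>G\<^esub> H \<and> openin T {a \<in> carrier G. a <#\<^bsub>G\<^esub> H \<in> U}"
    moreover have "{a \<in> carrier G. a <#\<^bsub>G\<^esub> H \<in> S \<inter> U} =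
        {a \<in> carrier G. a <#\<^bsub>G\<^esub> H \<in> S} \<inter> {a \<in> carrier G. a <#\<^bsub>G\<^esub> H \<in> U}"
      by auto
    ultimately show "S \<inter> U \<subseteq> lcosets\<^bsub>G\<^esub> H" "openin T {a \<in> carrier G. a <#\<^bsub>G\<^esub> H \<in> S \<inter> U}"
      by (auto intro: openin_Int)
  next
    fix \<K>
    assume K: "\<forall>K\<in>\<K>. K \<subseteq> lcosets\<^bsub>G\<^esub> H \<and> openin T {a \<in> carrier G. a <#\<^bsub>G\<^esub> H \<in> K}"
    then show "\<Union>\<K> \<subseteq> lcosets\<^bsub>G\<^esub> H"
      by auto
    have "{a \<in> carrier G. a <#\<^bsub>G\<^esub> H \<in> \<Union>\<K>} = (\<Union>K\<in>\<K>. {a \<in> carrier G. a <#\<^bsub>G\<^esub> H \<in> K})"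
      by auto
    with K show "openin T {a \<in> carrier G. a <#\<^bsub>G\<^esub> H \<in> \<Union>\<K>}"
      by auto
  qed
  then show ?thesis
    by (simp add: coset_topology_def)
qed

lemma (in topological_gyrogroup) topspace_coset_topology:
  "topspace (coset_topology G T H) = lcosets H"
proof
  show "topspace (coset_topology G T H) \<subseteq> lcosets H"
    by (auto simp: topspace_def openin_coset_topology)
  have "{a \<in> carrier G. a <# H \<in> lcosets H} = topspace T"
    by (auto simp: topspace_eq LCOSETS_def)
  then have "openin (coset_topology G T H) (lcosets H)"
    by (simp add: openin_coset_topology)
  then show "lcosets H \<subseteq> topspace (coset_topology G T H)"
    by (rule openin_subset)
qed

lemma (in topological_gyrogroup) quotient_map_coset_topology:
  "quotient_map T (coset_topology G T H) (\<lambda>a. a <# H)"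
  unfolding quotient_map_def topspace_coset_topology
  by (auto simp: openin_coset_topology topspace_eq LCOSETS_def)

text \<open>
  The index set \<open>nat \<Rightarrow> nat\<close> carries the pointwise order; starting the natural numbers at \<open>0\<close>
  rather than at \<open>1\<close> only relabels it by an order isomorphism.  The members of the base need
  not be open.
\<close>

definition has_omega_omega_base :: "'a topology \<Rightarrow> bool" where
  "has_omega_omega_base X \<longleftrightarrow>
     (\<forall>x\<in>topspace X. \<exists>U :: (nat \<Rightarrow> nat) \<Rightarrow> 'a set.
        (\<forall>\<alpha>. U \<alpha> \<subseteq> topspace X \<and> (\<exists>V. openin X V \<and> x \<in> V \<and> V \<subseteq> U \<alpha>)) \<and>
        (\<forall>W. openin X W \<and> x \<in> W \<longrightarrow> (\<exists>\<alpha>. U \<alpha> \<subseteq> W)) \<and>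
        (\<forall>\<alpha> \<beta>. \<alpha> \<le> \<beta> \<longrightarrow> U \<beta> \<subseteq> U \<alpha>))"

end

theory Submission
  imports Defs
begin

text \<open>
  Let \<open>U n\<close> be decreasing open neighbourhoods of the identity such that the traces on \<open>H\<close> of
  \<open>\<ominus>U n \<oplus> U n\<close> shrink to the identity, and let \<open>O \<alpha>\<close> be a base of \<open>G/H\<close> at \<open>H\<close>.  The sets
  \<open>U n \<inter> \<pi>\<^sup>-\<^sup>1(O \<alpha>)\<close> form a base of \<open>G\<close> at the identity: given \<open>V \<oplus> V \<subseteq> W\<close>, choose \<open>n\<close> with
  \<open>(\<ominus>U n \<oplus> U n) \<inter> H \<subseteq> V\<close> and then \<open>O \<alpha> \<subseteq> \<pi>(V \<inter> U n)\<close>, which is possible as \<open>\<pi>\<close> is open.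
  A point \<open>x\<close> of \<open>U n \<inter> \<pi>\<^sup>-\<^sup>1(O \<alpha>)\<close> is \<open>v \<oplus> h\<close> with \<open>v \<in> V \<inter> U n\<close> and \<open>h \<in> H\<close>, so
  \<open>h = \<ominus>v \<oplus> x \<in> V\<close> by left cancellation and \<open>x \<in> W\<close>.  The index set \<open>\<nat> \<times> \<nat>\<^sup>\<nat>\<close> is order
  isomorphic to \<open>\<nat>\<^sup>\<nat>\<close>, and left translations carry the base to every point of \<open>G\<close>.
\<close>

section \<open>Decreasing countable neighbourhood bases\<close>

lemma first_countable_decreasing_base:
  assumes "first_countable X" and x: "x \<in> topspace X"
  obtains B :: "nat \<Rightarrow> 'a set" where "\<And>n. openin X (B n)" "\<And>n. x \<in> B n" "decseq B"
    "\<And>U. openin X U \<Longrightarrow> x \<in> U \<Longrightarrow> \<exists>n. B n \<subseteq> U"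
proof -
  obtain \<B> where \<B>: "countable \<B>" "\<And>V. V \<in> \<B> \<Longrightarrow> openin X V"
    and base: "\<And>U. openin X U \<Longrightarrow> x \<in> U \<Longrightarrow> \<exists>V\<in>\<B>. x \<in> V \<and> V \<subseteq> U"
    using assms unfolding first_countable_def by metis
  define \<C> where "\<C> = {V \<in> \<B>. x \<in> V}"
  have ne: "\<C> \<noteq> {}" and ct: "countable \<C>"
    using base[OF openin_topspace x] \<B> by (auto simp: \<C>_def)
  \<comment> \<open>Finite intersections along an enumeration make the base decreasing. Each value
    of \<open>from_nat_into \<C>\<close> lies in \<open>\<C>\<close> even when \<open>\<C>\<close>
    is finite, since \<open>\<C>\<close> is nonempty.\<close>
  define B where "B n = (\<Inter>i\<le>n. from_nat_into \<C> i)" for n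
  have mem: "from_nat_into \<C> i \<in> \<C>" for i
    by (rule from_nat_into[OF ne])
  have "openin X (B n)" for n
    unfolding B_def using mem \<B> by (intro openin_INT2) (auto simp: \<C>_def)
  moreover have "x \<in> B n" for n
    using mem by (auto simp: B_def \<C>_def)
  moreover have "decseq B"
    unfolding B_def decseq_def by force
  moreover have "\<exists>n. B n \<subseteq> U" if U: "openin X U" "x \<in> U" for U
  proof -
    obtain V where V: "V \<in> \<C>" "V \<subseteq> U"
      using base[OF U] by (auto simp: \<C>_def)
    then obtain n where "from_nat_into \<C> n = V"
      using from_nat_into_surj[OF ct] by blast
    with V show ?thesis
      unfolding B_def by blast
  qed
  ultimately show thesis
    by (rule that)
qed

section \<open>Cancellation laws in gyrogroups\<close>

context gyrogroup
begin

lemma m_inv_props: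
  assumes "x \<in> carrier G"
  shows "inv x \<in> carrier G" "inv x \<otimes> x = \<one>" "x \<otimes> inv x = \<one>"
proof -
  \<comment> \<open>The conjuncts are put in the order of the definite description in
    \<open>m_inv_def\<close>.\<close>
  have "\<exists>!y. y \<in> carrier G \<and> x \<otimes> y = \<one> \<and> y \<otimes> x = \<one>"
    using inv_ex1[OF assms] by metis
  from theI'[OF this]
  show "inv x \<in> carrier G" "inv x \<otimes> x = \<one>" "x \<otimes> inv x = \<one>"
    unfolding m_inv_def by auto
qed

lemma inv_inv:
  assumes "x \<in> carrier G"
  shows "inv (inv x) = x"
  using m_inv_props[OF assms] m_inv_props[of "inv x"] inv_ex1[of "inv x"] assms by metis

lemma gyr_inj:
  assumes "x \<in> carrier G" "y \<in> carrier G"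
  shows "inj_on (gyr x y) (carrier G)"
  using gyr_aut[OF assms] by (simp add: iso_def bij_betw_def)

lemma gyr_closed:
  assumes "x \<in> carrier G" "y \<in> carrier G" "z \<in> carrier G"
  shows "gyr x y z \<in> carrier G"
  using gyr_aut[OF assms(1,2)] assms(3) by (auto simp: iso_def hom_def)

text \<open>Multiplying by \<open>inv x\<close> on the left turns \<open>x \<otimes> z\<close> into
  \<open>gyr (inv x) x z\<close>, and gyrations are injective. That this gyration is the identity is
  derived later, from cancellation itself.\<close>

lemma m_lcancel:
  assumes "x \<in> carrier G" "a \<in> carrier G" "b \<in> carrier G" and eq: "x \<otimes> a = x \<otimes> b"
  shows "a = b"
proof -
  have "gyr (inv x) x z = inv x \<otimes> (x \<otimes> z)" if "z \<in> carrier G" for z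
    using that assms(1) by (simp add: gyr_assoc m_inv_props gyr_closed l_one)
  then have "gyr (inv x) x a = gyr (inv x) x b"
    using assms by simp
  then show ?thesis
    using gyr_inj[of "inv x" x] assms by (auto simp: m_inv_props dest: inj_onD)
qed

text \<open>Gyroassociativity with first factor \<open>\<one>\<close> gives
  \<open>x \<otimes> z = x \<otimes> gyr \<one> x z\<close>; cancel \<open>x\<close>.\<close>

lemma gyr_one_left:
  assumes "x \<in> carrier G" "z \<in> carrier G"
  shows "gyr \<one> x z = z"
proof (rule m_lcancel[of x])
  show "x \<otimes> gyr \<one> x z = x \<otimes> z"
    using gyr_assoc[OF one_closed assms] assms by (simp add: l_one m_closed)
qed (use assms in \<open>auto intro: gyr_closed one_closed\<close>)

text \<open>As \<open>inv x \<otimes> x = \<one>\<close>, the loop property identifies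
  \<open>gyr (inv x) x\<close> with \<open>gyr \<one> x\<close>, which is the identity.\<close>

lemma inv_m_cancel:
  assumes "x \<in> carrier G" "z \<in> carrier G"
  shows "inv x \<otimes> (x \<otimes> z) = z"
proof -
  have "gyr (inv x) x z = z"
    using gyr_loop[of "inv x" x z] assms by (simp add: m_inv_props gyr_one_left)
  then show ?thesis
    using assms by (simp add: gyr_assoc m_inv_props l_one)
qed

lemma m_inv_cancel:
  assumes "x \<in> carrier G" "z \<in> carrier G"
  shows "x \<otimes> (inv x \<otimes> z) = z"
  using inv_m_cancel[of "inv x" z] assms by (simp add: m_inv_props inv_inv)

section \<open>L-subgyrogroups and their left cosets\<close>

lemma L_subgyrogroup_subset:
  assumes "L_subgyrogroup G gyr H"
  shows "H \<subseteq> carrier G"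
  using assms by (simp add: L_subgyrogroup_def subgyrogroup_def)

text \<open>The identity \<open>e\<close> of \<open>H\<close> satisfies
  \<open>e \<otimes> e = e = e \<otimes> \<one>\<close>, so left cancellation in \<open>G\<close>
  forces \<open>e = \<one>\<close>. Cancellation then also identifies inverses in \<open>H\<close>
  with those in \<open>G\<close>.\<close>

lemma L_subgyrogroup_closed:
  assumes "L_subgyrogroup G gyr H"
  shows "\<one> \<in> H"
    and "\<And>h k. h \<in> H \<Longrightarrow> k \<in> H \<Longrightarrow> h \<otimes> k \<in> H"
    and "\<And>h. h \<in> H \<Longrightarrow> inv h \<in> H"
proof -
  note sub = subsetD[OF L_subgyrogroup_subset[OF assms]]
  obtain e gyr' where "gyrogroup (G\<lparr>carrier := H, one := e\<rparr>) gyr'"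
    using assms by (auto simp: L_subgyrogroup_def subgyrogroup_def)
  then interpret K: gyrogroup "G\<lparr>carrier := H, one := e\<rparr>" gyr' .
  have e: "e \<in> H" "e \<otimes> e = e"
    using K.one_closed K.l_one by auto
  with sub have "e = \<one>"
    using m_lcancel[of e e \<one>] by (auto simp: r_one one_closed)
  with e show "\<one> \<in> H" by simp
  show "h \<otimes> k \<in> H" if "h \<in> H" "k \<in> H" for h k
    using K.m_closed that by simp
  show "inv h \<in> H" if h: "h \<in> H" for h
  proof -
    obtain y where y: "y \<in> H" "y \<otimes> h = \<one>" "h \<otimes> y = \<one>"
      using K.inv_ex1[of h] h \<open>e = \<one>\<close> by auto
    then have "y = inv h"
      using m_lcancel[of h y "inv h"] h sub m_inv_props[of h] by auto
    with y show ?thesis by simp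
  qed
qed

text \<open>In \<open>a \<otimes> (h \<otimes> k) = (a \<otimes> h) \<otimes> gyr a h k\<close>,
  both \<open>h \<otimes> k\<close> and \<open>gyr a h k\<close> run through all of \<open>H\<close>
  as \<open>k\<close> does; the latter is the L-property.\<close>

lemma l_coset_m_L_subgyrogroup:
  assumes L: "L_subgyrogroup G gyr H" and a: "a \<in> carrier G" and h: "h \<in> H"
  shows "(a \<otimes> h) <# H = a <# H"
proof -
  note sub = subsetD[OF L_subgyrogroup_subset[OF L]]
  note closed = L_subgyrogroup_closed[OF L]
  have gyrH: "gyr a h ` H = H"
    using L a h by (simp add: L_subgyrogroup_def)
  have hH: "(\<lambda>k. h \<otimes> k) ` H = H"
  proof
    show "(\<lambda>k. h \<otimes> k) ` H \<subseteq> H" using closed h by auto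
    show "H \<subseteq> (\<lambda>k. h \<otimes> k) ` H"
    proof
      fix k assume "k \<in> H"
      then have "k = h \<otimes> (inv h \<otimes> k)" "inv h \<otimes> k \<in> H"
        using m_inv_cancel[of h k] closed h sub by auto
      then show "k \<in> (\<lambda>k. h \<otimes> k) ` H" by (rule image_eqI)
    qed
  qed
  have "(a \<otimes> h) <# H = (\<lambda>k. (a \<otimes> h) \<otimes> k) ` gyr a h ` H"
    unfolding gyrH by (auto simp: l_coset_def)
  also have "\<dots> = (\<lambda>k. a \<otimes> k) ` (\<lambda>k. h \<otimes> k) ` H"
    unfolding image_image using gyr_assoc[of a h] a h sub by (intro image_cong) auto
  also have "\<dots> = a <# H"
    unfolding hH by (auto simp: l_coset_def)
  finally show ?thesis .
qed

lemma mem_l_coset_self: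
  assumes "L_subgyrogroup G gyr H" "a \<in> carrier G"
  shows "a \<in> a <# H"
  using L_subgyrogroup_closed(1)[OF assms(1)] assms(2) r_one by (force simp: l_coset_def)

end

section \<open>Open cosets and neighbourhoods of the identity\<close>

context topological_gyrogroup
begin

lemma continuous_map_m:
  assumes "continuous_map X T f" "continuous_map X T g"
  shows "continuous_map X T (\<lambda>x. f x \<otimes> g x)"
  using continuous_map_compose[OF continuous_map_pairedI[OF assms] continuous_mult]
  by (simp add: o_def)

text \<open>Joint continuity at a diagonal point, with one neighbourhood serving both arguments. It
  is applied to \<open>x \<otimes> y\<close> and to \<open>inv x \<otimes> y\<close>.\<close>

lemma openin_prod_preimage_square:
  assumes f: "continuous_map (prod_topology T T) T (\<lambda>(x, y). f x y)"
    and W: "openin T W" and a: "a \<in> carrier G" "f a a \<in> W"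
  obtains V where "openin T V" "a \<in> V" "\<And>x y. x \<in> V \<Longrightarrow> y \<in> V \<Longrightarrow> f x y \<in> W"
proof -
  let ?P = "{p \<in> topspace (prod_topology T T). (\<lambda>(x, y). f x y) p \<in> W}"
  have "openin (prod_topology T T) ?P"
    by (rule openin_continuous_map_preimage[OF f W])
  moreover have "(a, a) \<in> ?P"
    using a by (simp add: topspace_eq)
  ultimately obtain A B where AB: "openin T A" "openin T B" "a \<in> A" "a \<in> B" "A \<times> B \<subseteq> ?P"
    unfolding openin_prod_topology_alt by meson
  show thesis
  proof (rule that[of "A \<inter> B"])
    show "f x y \<in> W" if "x \<in> A \<inter> B" "y \<in> A \<inter> B" for x y
      using that AB(5) by auto
  qed (use AB in auto)
qed

text \<open>The saturation of \<open>V\<close> is the union over \<open>h \<in> H\<close> of the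
  preimages of \<open>V\<close> under the right translations by \<open>h\<close>, each open by
  continuity.\<close>

lemma openin_image_l_coset:
  assumes L: "L_subgyrogroup G gyr H" and V: "openin T V"
  shows "openin (coset_topology G T H) ((\<lambda>a. a <# H) ` V)"
proof -
  note sub = subsetD[OF L_subgyrogroup_subset[OF L]]
  have VG: "V \<subseteq> carrier G"
    using openin_subset[OF V] by (simp add: topspace_eq)
  have "{a \<in> carrier G. a <# H \<in> (\<lambda>a. a <# H) ` V}
      = (\<Union>h\<in>H. {a \<in> topspace T. a \<otimes> h \<in> V})" (is "?L = ?R")
  proof (intro equalityI subsetI)
    fix a assume "a \<in> ?L"
    then obtain v where a: "a \<in> carrier G" and v: "v \<in> V" "a <# H = v <# H"
      by auto
    then have "v \<in> a <# H"
      using mem_l_coset_self[OF L] VG by auto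
    then obtain h where "h \<in> H" "v = a \<otimes> h"
      by (auto simp: l_coset_def)
    with a v(1) show "a \<in> ?R"
      by (auto simp: topspace_eq)
  next
    fix a assume "a \<in> ?R"
    then obtain h where "a \<in> carrier G" "h \<in> H" "a \<otimes> h \<in> V"
      by (auto simp: topspace_eq)
    then show "a \<in> ?L"
      using l_coset_m_L_subgyrogroup[OF L, of a h] by (auto intro: image_eqI[where x = "a \<otimes> h"])
  qed
  moreover have "openin T {a \<in> topspace T. a \<otimes> h \<in> V}" if "h \<in> H" for h
    using that sub V by (intro openin_continuous_map_preimage[OF continuous_map_m])
      (auto simp: topspace_eq)
  ultimately have "openin T {a \<in> carrier G. a <# H \<in> (\<lambda>a. a <# H) ` V}"
    by auto
  then show ?thesis
    using VG by (auto simp: openin_coset_topology LCOSETS_def)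
qed

text \<open>By left cancellation, the translations by \<open>x\<close> and by \<open>inv x\<close>
  are mutually inverse homeomorphisms. The base at \<open>x\<close> is the preimage of
  \<open>B\<close> under translation by \<open>inv x\<close>.\<close>

lemma has_omega_omega_base_if_at_one:
  fixes B :: "(nat \<Rightarrow> nat) \<Rightarrow> 'a set"
  assumes nbhd: "\<And>\<alpha>. \<exists>V. openin T V \<and> \<one> \<in> V \<and> V \<subseteq> B \<alpha>"
    and base: "\<And>W. openin T W \<Longrightarrow> \<one> \<in> W \<Longrightarrow> \<exists>\<alpha>. B \<alpha> \<subseteq> W"
    and antimono: "\<And>\<alpha> \<beta>. \<alpha> \<le> \<beta> \<Longrightarrow> B \<beta> \<subseteq> B \<alpha>"
  shows "has_omega_omega_base T"
  unfolding has_omega_omega_base_def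
proof
  fix x assume "x \<in> topspace T"
  then have x: "x \<in> carrier G" "inv x \<in> carrier G"
    by (auto simp: topspace_eq m_inv_props)
  have cont: "continuous_map T T (\<lambda>y. a \<otimes> y)" if "a \<in> carrier G" for a
    using that by (intro continuous_map_m) (auto simp: topspace_eq)
  define U where "U \<alpha> = {y \<in> topspace T. inv x \<otimes> y \<in> B \<alpha>}" for \<alpha>
  have "\<exists>V. openin T V \<and> x \<in> V \<and> V \<subseteq> U \<alpha>" for \<alpha>
  proof -
    obtain V where V: "openin T V" "\<one> \<in> V" "V \<subseteq> B \<alpha>"
      using nbhd by blast
    have "openin T {y \<in> topspace T. inv x \<otimes> y \<in> V}"
      using cont[OF x(2)] V(1) by (rule openin_continuous_map_preimage)
    moreover have "x \<in> {y \<in> topspace T. inv x \<otimes> y \<in> V}"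
      using x V by (simp add: m_inv_props topspace_eq)
    moreover have "{y \<in> topspace T. inv x \<otimes> y \<in> V} \<subseteq> U \<alpha>"
      using V by (auto simp: U_def)
    ultimately show ?thesis by blast
  qed
  moreover have "\<exists>\<alpha>. U \<alpha> \<subseteq> W" if W: "openin T W" "x \<in> W" for W
  proof -
    have "openin T {y \<in> topspace T. x \<otimes> y \<in> W}"
      using cont[OF x(1)] W(1) by (rule openin_continuous_map_preimage)
    moreover have "\<one> \<in> {y \<in> topspace T. x \<otimes> y \<in> W}"
      using x W by (simp add: one_closed r_one topspace_eq)
    ultimately obtain \<alpha> where \<alpha>: "B \<alpha> \<subseteq> {y \<in> topspace T. x \<otimes> y \<in> W}"
      using base by blast
    have "y \<in> W" if "y \<in> U \<alpha>" for y
    proof -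
      have "x \<otimes> (inv x \<otimes> y) \<in> W"
        using that \<alpha> by (auto simp: U_def)
      with that x show ?thesis
        by (simp add: U_def topspace_eq m_inv_cancel)
    qed
    then show ?thesis by blast
  qed
  moreover have "U \<alpha> \<subseteq> topspace T" for \<alpha>
    by (auto simp: U_def)
  moreover have "U \<beta> \<subseteq> U \<alpha>" if "\<alpha> \<le> \<beta>" for \<alpha> \<beta>
    using antimono[OF that] by (auto simp: U_def)
  ultimately show "\<exists>U :: (nat \<Rightarrow> nat) \<Rightarrow> 'a set.
      (\<forall>\<alpha>. U \<alpha> \<subseteq> topspace T \<and> (\<exists>V. openin T V \<and> x \<in> V \<and> V \<subseteq> U \<alpha>)) \<and>
      (\<forall>W. openin T W \<and> x \<in> W \<longrightarrow> (\<exists>\<alpha>. U \<alpha> \<subseteq> W)) \<and>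
      (\<forall>\<alpha> \<beta>. \<alpha> \<le> \<beta> \<longrightarrow> U \<beta> \<subseteq> U \<alpha>)"
    by (intro exI[of _ U]) blast
qed

lemma decreasing_nhds_with_differences_in:
  assumes B: "\<And>n. openin T (B n)" "\<And>n. \<one> \<in> B n"
  obtains U :: "nat \<Rightarrow> 'a set" where "\<And>n. openin T (U n)" "\<And>n. \<one> \<in> U n" "decseq U"
    "\<And>n x y. x \<in> U n \<Longrightarrow> y \<in> U n \<Longrightarrow> inv x \<otimes> y \<in> B n"
proof -
  have cont: "continuous_map (prod_topology T T) T (\<lambda>(x, y). inv x \<otimes> y)"
    using continuous_map_m[OF continuous_map_compose[OF continuous_map_fst continuous_inv]
        continuous_map_snd]
    by (simp add: o_def case_prod_unfold)
  have one: "inv \<one> \<otimes> \<one> = \<one>"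
    by (simp add: m_inv_props one_closed)
  have "\<exists>V. openin T V \<and> \<one> \<in> V \<and> (\<forall>x\<in>V. \<forall>y\<in>V. inv x \<otimes> y \<in> B n)" for n
    using openin_prod_preimage_square[OF cont B(1) one_closed, of n] B(2) one by metis
  then obtain V where V: "\<And>n. openin T (V n)" "\<And>n. \<one> \<in> V n"
      "\<And>n x y. x \<in> V n \<Longrightarrow> y \<in> V n \<Longrightarrow> inv x \<otimes> y \<in> B n"
    by metis
  \<comment> \<open>Intersecting the first \<open>n + 1\<close> sets makes the sequence decreasing
    and keeps the result inside \<open>V n\<close>.\<close>
  show thesis
  proof (rule that[of "\<lambda>n. \<Inter>i\<le>n. V i"])
    show "openin T (\<Inter>i\<le>n. V i)" for n
      using V by (intro openin_INT2) auto
    show "decseq (\<lambda>n. \<Inter>i\<le>n. V i)"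
      unfolding decseq_def by force
    show "inv x \<otimes> y \<in> B n" if "x \<in> (\<Inter>i\<le>n. V i)" "y \<in> (\<Inter>i\<le>n. V i)" for n x y
      using that V(3) by blast
  qed (use V in auto)
qed

section \<open>Combining the bases of \<open>H\<close> and \<open>G/H\<close>\<close>

lemma has_omega_omega_base_if_quotient:
  assumes L: "L_subgyrogroup G gyr H"
    and fc: "first_countable (subtopology T H)"
    and quot: "has_omega_omega_base (coset_topology G T H)"
  shows "has_omega_omega_base T"
proof -
  let ?\<pi> = "\<lambda>a. a <# H" and ?Q = "coset_topology G T H"
  note sub = subsetD[OF L_subgyrogroup_subset[OF L]]
  have oneH: "\<one> \<in> topspace (subtopology T H)"
    using L_subgyrogroup_closed(1)[OF L] one_closed by (simp add: topspace_eq)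
  obtain C where C: "\<And>n. openin (subtopology T H) (C n)" "\<And>n. \<one> \<in> C n" "decseq C"
    "\<And>U. openin (subtopology T H) U \<Longrightarrow> \<one> \<in> U \<Longrightarrow> \<exists>n. C n \<subseteq> U"
    using first_countable_decreasing_base[OF fc oneH] by metis
  \<comment> \<open>Differences of points near \<open>\<one>\<close> need not lie in
    \<open>H\<close>, so the base of \<open>H\<close> is extended to open sets of
    \<open>G\<close>.\<close>
  have "\<exists>B. openin T B \<and> C n = B \<inter> H" for n
    using C(1) by (simp add: openin_subtopology)
  then obtain B where B: "\<And>n. openin T (B n)" "\<And>n. C n = B n \<inter> H"
    by metis
  obtain U where U: "\<And>n. openin T (U n)" "\<And>n. \<one> \<in> U n" "decseq U"
    "\<And>n x y. x \<in> U n \<Longrightarrow> y \<in> U n \<Longrightarrow> inv x \<otimes> y \<in> B n"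
    using decreasing_nhds_with_differences_in[of B] B C(2) by (metis IntD1)
  have "?\<pi> \<one> \<in> topspace ?Q"
    using one_closed by (auto simp: topspace_coset_topology LCOSETS_def)
  then obtain N :: "(nat \<Rightarrow> nat) \<Rightarrow> 'a set set" where
      N: "\<And>\<alpha>. \<exists>V. openin ?Q V \<and> ?\<pi> \<one> \<in> V \<and> V \<subseteq> N \<alpha>"
      "\<And>W. openin ?Q W \<Longrightarrow> ?\<pi> \<one> \<in> W \<Longrightarrow> \<exists>\<alpha>. N \<alpha> \<subseteq> W"
      "\<And>\<alpha> \<beta>. \<alpha> \<le> \<beta> \<Longrightarrow> N \<beta> \<subseteq> N \<alpha>"
    using quot unfolding has_omega_omega_base_def by metis
  show ?thesis
  \<comment> \<open>A single \<open>\<alpha>\<close> encodes the pair of its value at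
    \<open>0\<close> and its shifted tail; the pointwise order becomes the product order.\<close>
  proof (rule has_omega_omega_base_if_at_one
      [where B = "\<lambda>\<alpha>. {x \<in> U (\<alpha> 0). ?\<pi> x \<in> N (\<lambda>n. \<alpha> (Suc n))}"])
    fix \<alpha> :: "nat \<Rightarrow> nat"
    obtain V where V: "openin ?Q V" "?\<pi> \<one> \<in> V" "V \<subseteq> N (\<lambda>n. \<alpha> (Suc n))"
      using N(1) by blast
    have "openin T (U (\<alpha> 0) \<inter> {a \<in> carrier G. ?\<pi> a \<in> V})"
      using U(1) V(1) by (auto simp: openin_coset_topology)
    moreover have "\<one> \<in> U (\<alpha> 0) \<inter> {a \<in> carrier G. ?\<pi> a \<in> V}"
      using U V one_closed by auto
    ultimately show "\<exists>V. openin T V \<and> \<one> \<in> V \<and>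
        V \<subseteq> {x \<in> U (\<alpha> 0). ?\<pi> x \<in> N (\<lambda>n. \<alpha> (Suc n))}"
      using V(3) by blast
  next
    fix W assume W: "openin T W" "\<one> \<in> W"
    then obtain V where V: "openin T V" "\<one> \<in> V" "\<And>x y. x \<in> V \<Longrightarrow> y \<in> V \<Longrightarrow> x \<otimes> y \<in> W"
      using openin_prod_preimage_square[OF continuous_mult W(1) one_closed]
      by (metis l_one one_closed)
    have "openin (subtopology T H) (V \<inter> H)"
      using V(1) by (auto simp: openin_subtopology)
    then obtain n where n: "B n \<inter> H \<subseteq> V"
      using C(4)[of "V \<inter> H"] V(2) oneH B(2) by auto
    have "openin ?Q (?\<pi> ` (V \<inter> U n))"
      using V(1) U(1) by (intro openin_image_l_coset[OF L] openin_Int)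
    moreover have "?\<pi> \<one> \<in> ?\<pi> ` (V \<inter> U n)"
      using V(2) U(2) by blast
    ultimately obtain \<beta> where \<beta>: "N \<beta> \<subseteq> ?\<pi> ` (V \<inter> U n)"
      using N(2) by blast
    have "x \<in> W" if x: "x \<in> U n" "?\<pi> x \<in> N \<beta>" for x
    proof -
      have xG: "x \<in> carrier G"
        using openin_subset[OF U(1)] x(1) by (auto simp: topspace_eq)
      obtain v where v: "v \<in> V" "v \<in> U n" "?\<pi> x = ?\<pi> v"
        using x(2) \<beta> by auto
      then have vG: "v \<in> carrier G"
        using openin_subset[OF V(1)] by (auto simp: topspace_eq)
      have "x \<in> ?\<pi> v"
        using mem_l_coset_self[OF L xG] v(3) by simp
      then obtain h where h: "h \<in> H" "x = v \<otimes> h"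
        by (auto simp: l_coset_def)
      \<comment> \<open>This writes \<open>h\<close> as a difference of two points of
        \<open>U n\<close>, so \<open>h \<in> B n \<inter> H \<subseteq> V\<close>.\<close>
      then have "h = inv v \<otimes> x"
        using inv_m_cancel[OF vG] sub by auto
      with U(4)[OF v(2) x(1)] h(1) n have "h \<in> V"
        by auto
      with V(3)[OF v(1)] h(2) show ?thesis
        by simp
    qed
    then show "\<exists>\<alpha>. {x \<in> U (\<alpha> 0). ?\<pi> x \<in> N (\<lambda>n. \<alpha> (Suc n))} \<subseteq> W"
      \<comment> \<open>Prepending \<open>n\<close> to \<open>\<beta>\<close> inverts the encoding
        of pairs.\<close>
      by (intro exI[of _ "case_nat n \<beta>"]) auto
  next
    fix \<alpha> \<beta> :: "nat \<Rightarrow> nat" assume le: "\<alpha> \<le> \<beta>"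
    then have "U (\<beta> 0) \<subseteq> U (\<alpha> 0)"
      using U(3) by (simp add: decseq_def le_fun_def)
    moreover have "N (\<lambda>n. \<beta> (Suc n)) \<subseteq> N (\<lambda>n. \<alpha> (Suc n))"
      using le by (intro N(3)) (simp add: le_fun_def)
    ultimately show "{x \<in> U (\<beta> 0). ?\<pi> x \<in> N (\<lambda>n. \<beta> (Suc n))}
        \<subseteq> {x \<in> U (\<alpha> 0). ?\<pi> x \<in> N (\<lambda>n. \<alpha> (Suc n))}"
      by blast
  qed
qed

end

theorem theorem5p2:
  fixes G :: "('a, 'b) monoid_scheme"
    and gyr :: "'a \<Rightarrow> 'a \<Rightarrow> 'a \<Rightarrow> 'a"
    and T :: "'a topology"
    and H :: "'a set"
  assumes "topological_gyrogroup G gyr T"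
    and "L_subgyrogroup G gyr H"
    and "closedin T H"
    and "first_countable (subtopology T H)"
    and "has_omega_omega_base (coset_topology G T H)"
  shows "has_omega_omega_base T"
  using assms topological_gyrogroup.has_omega_omega_base_if_quotient by blast

end
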